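(* Let $P$ be a Markov transition kernel on a Polish space $H$ with metric $\rho$, and let $\tilde\rho$ be a (possibly different) distance on $H$. Suppose that $\mathcal G_{\tilde\rho}$ determines measures on $(H,\rho)$ and that $D_{\tilde\rho}$ is a measurable subset of $H^{\mathbf N}\times H^{\mathbf N}$. If $H_0\subset H$ is a measurable set such that for each pair $u_0,v_0\in H_0$ there exists $\Gamma\in\tilde{\mathcal C}(\delta_{u_0}P^{\mathbf N},\delta_{v_0}P^{\mathbf N})$ with $\Gamma(D_{\tilde\rho})>0$, then there exists at most one ergodic invariant measure $\mu$ for $P$ with $\mu(H_0)>0$.
   Context: $H$ is equipped with the Borel $\sigma$-algebra of $\rho$, $C_b(H)$ denotes the bounded $\rho$-continuous real functions on $H$, and $\mathbf N=\{1,2,\dots\}$. For a bounded measurable $\phi:H\to\mathbb R$, $P\phi(u)=\int_H\phi(v)P(u,dv)$; for a probability measure $\nu$ on $H$, $\nu P(A)=\int_H P(u,A)\,\nu(du)$. An invariant measure for $P$ is a (Borel) probability measure $\mu$ on $H$ with $\mu P=\mu$. It is ergodic if $\mu(A)\in\{0,1\}$ for every measurable $A\subset H$ with $P\mathbf 1_A=\mathbf 1_A$ $\mu$-a.e. $H^{\mathbf N}$ is the space of sequences $u=(u_1,u_2,\dots)$ in $H$ with the product $\sigma$-algebra. For a probability measure $\nu$ on $H$, $\nu P^{\mathbf N}$ is the law on $H^{\mathbf N}$ of $(U_1,U_2,\dots)$, where $U_0$ has law $\nu$ and, given $U_{k-1}$, $U_k$ has law $P(U_{k-1},\cdot)$ (a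 Markov chain with kernel $P$). $\delta_{u_0}$ is the Dirac measure at $u_0$. For probability measures $M_1,M_2$ on $H^{\mathbf N}$, $\tilde{\mathcal C}(M_1,M_2)$ is the set of probability measures $\Gamma$ on $H^{\mathbf N}\times H^{\mathbf N}$ such that $\Gamma\Pi_i^{-1}\ll M_i$ for $i=1,2$, where $\Pi_1(u,v)=u$, $\Pi_2(u,v)=v$. Define $$D_{\tilde\rho}=\Big\{(u,v)\in H^{\mathbf N}\times H^{\mathbf N}:\ \lim_{n\to\infty}\tilde\rho(u_n,v_n)=0\Big\},\qquad \mathcal G_{\tilde\rho}=\Big\{\phi\in C_b(H):\ \sup_{u\neq v}\frac{|\phi(u)-\phi(v)|}{\tilde\rho(u,v)}<\infty\Big\}.$$ A set $\mathcal G$ of bounded, real-valued, measurable functions on $H$ determines measures if, whenever $\mu_1,\mu_2$ are Borel probability measures on $H$ with $\int\phi\,d\mu_1=\int\phi\,d\mu_2$ for all $\phi\in\mathcal G$, then $\mu_1=\mu_2$. *)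

theory Defs
  imports "HOL-Probability.Probability" "HOL-Analysis.Abstract_Metric_Spaces"
begin

text \<open>
  The Polish space \<open>(H, \<rho>)\<close> is a type of class \<^class>\<open>polish_space\<close> with \<open>\<rho> = dist\<close>; its
  \<open>\<sigma>\<close>-algebra is \<open>borel\<close>.  Borel probability measures on \<open>H\<close> are the elements of
  \<open>space (prob_algebra borel)\<close>, and \<open>\<nu>P\<close> is the Giry bind \<open>\<nu> \<bind> P\<close>.
\<close>

definition markov_kernel :: "('a::polish_space \<Rightarrow> 'a measure) \<Rightarrow> bool" where
  "markov_kernel P \<longleftrightarrow> P \<in> borel \<rightarrow>\<^sub>M prob_algebra borel"

definition kernel_op :: "('a \<Rightarrow> 'a measure) \<Rightarrow> ('a \<Rightarrow> real) \<Rightarrow> 'a \<Rightarrow> real" where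
  "kernel_op P \<phi> u = (\<integral>v. \<phi> v \<partial>P u)"

definition invariant_measure :: "('a::polish_space \<Rightarrow> 'a measure) \<Rightarrow> 'a measure \<Rightarrow> bool" where
  "invariant_measure P \<mu> \<longleftrightarrow> \<mu> \<in> space (prob_algebra borel) \<and> \<mu> \<bind> P = \<mu>"

definition ergodic_invariant :: "('a::polish_space \<Rightarrow> 'a measure) \<Rightarrow> 'a measure \<Rightarrow> bool" where
  "ergodic_invariant P \<mu> \<longleftrightarrow> invariant_measure P \<mu> \<and>
     (\<forall>A\<in>sets borel. (AE u in \<mu>. kernel_op P (indicator A) u = indicator A u) \<longrightarrow>
        measure \<mu> A \<in> {0, 1})"

text \<open>
  A sequence \<open>(u\<^sub>1, u\<^sub>2, \<dots>)\<close> is represented by a function on \<open>nat\<close> whose value at \<open>n\<close> is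
  \<open>u\<^bsub>n+1\<^esub>\<close>.
\<close>

abbreviation seq_space :: "(nat \<Rightarrow> 'a::polish_space) measure" where
  "seq_space \<equiv> Pi\<^sub>M UNIV (\<lambda>_. borel)"

text \<open>
  The law of the whole chain \<open>(U\<^sub>0, U\<^sub>1, \<dots>)\<close> is the Ionescu-Tulcea measure for the transition
  kernels below.  Here index \<open>n\<close> does stand for time \<open>n\<close>; the unused values of the function
  argument make the kernel formally depend on the whole past.
\<close>

definition chain_kernel ::
    "'a measure \<Rightarrow> ('a::polish_space \<Rightarrow> 'a measure) \<Rightarrow> nat \<Rightarrow> (nat \<Rightarrow> 'a) \<Rightarrow> 'a measure" where
  "chain_kernel \<nu> P n \<omega> = (case n of 0 \<Rightarrow> \<nu> | Suc k \<Rightarrow> P (\<omega> k))"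

definition chain_law ::
    "'a measure \<Rightarrow> ('a::polish_space \<Rightarrow> 'a measure) \<Rightarrow> (nat \<Rightarrow> 'a) measure" where
  "chain_law \<nu> P =
     projective_family.lim UNIV (Ionescu_Tulcea.CI (chain_kernel \<nu> P) (\<lambda>_. borel)) (\<lambda>_. borel)"

text \<open>The law \<open>\<nu>P\<^sup>N\<close> of \<open>(U\<^sub>1, U\<^sub>2, \<dots>)\<close>: the initial state \<open>U\<^sub>0\<close> is dropped.\<close>

definition path_law ::
    "'a measure \<Rightarrow> ('a::polish_space \<Rightarrow> 'a measure) \<Rightarrow> (nat \<Rightarrow> 'a) measure" where
  "path_law \<nu> P = distr (chain_law \<nu> P) seq_space (\<lambda>\<omega> n. \<omega> (Suc n))"

text \<open>The library's \<open>absolutely_continuous M N\<close> means \<open>N \<lless> M\<close>.\<close>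

definition ac_couplings ::
    "(nat \<Rightarrow> 'a::polish_space) measure \<Rightarrow> (nat \<Rightarrow> 'a) measure
       \<Rightarrow> ((nat \<Rightarrow> 'a) \<times> (nat \<Rightarrow> 'a)) measure set" where
  "ac_couplings M1 M2 =
     {\<Gamma> \<in> space (prob_algebra (seq_space \<Otimes>\<^sub>M seq_space)).
        absolutely_continuous M1 (distr \<Gamma> seq_space fst) \<and>
        absolutely_continuous M2 (distr \<Gamma> seq_space snd)}"

definition asymp_diagonal ::
    "('a \<Rightarrow> 'a \<Rightarrow> real) \<Rightarrow> ((nat \<Rightarrow> 'a) \<times> (nat \<Rightarrow> 'a)) set" where
  "asymp_diagonal d = {(u, v). (\<lambda>n. d (u n) (v n)) \<longlonglongrightarrow> 0}"

definition lip_test_functions :: "('a::polish_space \<Rightarrow> 'a \<Rightarrow> real) \<Rightarrow> ('a \<Rightarrow> real) set" where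
  "lip_test_functions d =
     {\<phi> \<in> bcontfun. bdd_above {\<bar>\<phi> u - \<phi> v\<bar> / d u v | u v. u \<noteq> v}}"

definition determines_measures :: "('a::polish_space \<Rightarrow> real) set \<Rightarrow> bool" where
  "determines_measures G \<longleftrightarrow>
     (\<forall>\<phi>\<in>G. \<phi> \<in> borel_measurable borel \<and> bounded (range \<phi>)) \<and>
     (\<forall>\<mu>1\<in>space (prob_algebra borel). \<forall>\<mu>2\<in>space (prob_algebra borel).
        (\<forall>\<phi>\<in>G. (\<integral>x. \<phi> x \<partial>\<mu>1) = (\<integral>x. \<phi> x \<partial>\<mu>2)) \<longrightarrow> \<mu>1 = \<mu>2)"

text \<open>
  Well-definedness of \<^const>\<open>chain_law\<close>: its finite-dimensional marginals are those of a Markov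
  chain with initial law \<open>\<nu>\<close> and kernel \<open>P\<close>.
\<close>

context
  fixes P :: "'a::polish_space \<Rightarrow> 'a measure" and \<nu> :: "'a measure"
  assumes P: "markov_kernel P" and \<nu>: "\<nu> \<in> space (prob_algebra borel)"
begin

lemma Ionescu_Tulcea_chain_kernel: "Ionescu_Tulcea (chain_kernel \<nu> P) (\<lambda>_. borel)"
proof (rule Ionescu_Tulcea.intro)
  have P': "P \<in> borel \<rightarrow>\<^sub>M subprob_algebra borel"
    using P unfolding markov_kernel_def by (rule measurable_prob_algebraD)
  have \<nu>': "\<nu> \<in> space (subprob_algebra borel)"
    using \<nu> by (auto simp: space_prob_algebra space_subprob_algebra prob_space_imp_subprob_space)
  show "chain_kernel \<nu> P i \<in> Pi\<^sub>M {0..<i} (\<lambda>_. borel) \<rightarrow>\<^sub>M subprob_algebra borel" for i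
  proof (cases i)
    case 0
    then show ?thesis
      using \<nu>' by (simp add: chain_kernel_def[abs_def])
  next
    case (Suc k)
    have "(\<lambda>\<omega>. P (\<omega> k)) \<in> Pi\<^sub>M {0..<i} (\<lambda>_. borel) \<rightarrow>\<^sub>M subprob_algebra borel"
      using Suc by (intro measurable_compose[OF _ P'] measurable_component_singleton) auto
    then show ?thesis
      by (simp add: Suc chain_kernel_def[abs_def])
  qed
  have "prob_space (P x)" for x
    using measurable_space[OF P[unfolded markov_kernel_def], of x]
    by (simp add: space_prob_algebra)
  then show "prob_space (chain_kernel \<nu> P i x)" for i x
    using \<nu> by (auto simp: chain_kernel_def space_prob_algebra split: nat.split)
qed

interpretation IT: Ionescu_Tulcea "chain_kernel \<nu> P" "\<lambda>_. borel"
  by (rule Ionescu_Tulcea_chain_kernel)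

lemma sets_chain_law: "sets (chain_law \<nu> P) = sets seq_space"
  by (simp add: chain_law_def IT.PF.sets_lim)

lemma distr_chain_law_eq_C:
  "distr (chain_law \<nu> P) (Pi\<^sub>M {0..<n} (\<lambda>_. borel)) (\<lambda>\<omega>. restrict \<omega> {0..<n}) =
     IT.C 0 n (\<lambda>_. undefined)"
proof -
  have "IT.up_to {0..<n} = n"
    unfolding IT.up_to_def
    by (rule Least_equality) (simp, metis atLeastLessThan_iff leI le_refl zero_le)
  then have "IT.CI {0..<n} =
      distr (IT.C 0 n (\<lambda>_. undefined)) (Pi\<^sub>M {0..<n} (\<lambda>_. borel)) (\<lambda>\<omega>. restrict \<omega> {0..<n})"
    by (simp add: IT.CI_def)
  also have "\<dots> = IT.C 0 n (\<lambda>_. undefined)"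
    using IT.distr_C[of n n "\<lambda>_. undefined" 0] by simp
  finally show ?thesis
    by (simp add: chain_law_def IT.distr_lim)
qed

lemma prob_space_chain_law: "prob_space (chain_law \<nu> P)"
proof (rule prob_space_distrD)
  show "(\<lambda>\<omega>. restrict \<omega> {0..<0}) \<in> chain_law \<nu> P \<rightarrow>\<^sub>M Pi\<^sub>M {0..<0} (\<lambda>_. borel)"
    by (auto intro!: measurable_restrict simp: measurable_cong_sets[OF sets_chain_law refl])
  show "prob_space
      (distr (chain_law \<nu> P) (Pi\<^sub>M {0..<0} (\<lambda>_. borel)) (\<lambda>\<omega>. restrict \<omega> {0..<0}))"
    unfolding distr_chain_law_eq_C by (rule IT.prob_space_C) simp
qed

lemma chain_law_initial: "distr (chain_law \<nu> P) borel (\<lambda>\<omega>. \<omega> 0) = \<nu>"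
proof -
  let ?M = "Pi\<^sub>M {0..<Suc 0} (\<lambda>_. borel :: 'a measure)"
  have \<nu>_sets: "sets \<nu> = sets borel"
    using \<nu> by (simp add: space_prob_algebra)
  have "distr (chain_law \<nu> P) borel (\<lambda>\<omega>. \<omega> 0) =
      distr (distr (chain_law \<nu> P) ?M (\<lambda>\<omega>. restrict \<omega> {0..<Suc 0})) borel (\<lambda>\<omega>. \<omega> 0)"
    by (subst distr_distr)
       (auto intro!: measurable_restrict measurable_component_singleton
          simp: measurable_cong_sets[OF sets_chain_law refl] comp_def)
  also have "\<dots> = distr (IT.eP 0 (\<lambda>_. undefined)) borel (\<lambda>\<omega>. \<omega> 0)"
    unfolding distr_chain_law_eq_C using bind_return[OF IT.measurable_eP[of 0], of "\<lambda>_. undefined"]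
    by (simp add: space_PiM)
  also have "\<dots> = distr \<nu> borel (\<lambda>x. x)"
    unfolding IT.eP_def
    by (subst distr_distr)
       (auto intro!: measurable_component_singleton measurable_fun_upd[where J="{0..<0}"]
          simp: chain_kernel_def comp_def measurable_cong_sets[OF \<nu>_sets refl] space_PiM)
  also have "\<dots> = \<nu>"
    using \<nu>_sets by (intro distr_id2) simp
  finally show ?thesis .
qed

lemma chain_law_step:
  "distr (chain_law \<nu> P) (Pi\<^sub>M {0..<Suc (Suc n)} (\<lambda>_. borel))
       (\<lambda>\<omega>. restrict \<omega> {0..<Suc (Suc n)}) =
   distr (chain_law \<nu> P) (Pi\<^sub>M {0..<Suc n} (\<lambda>_. borel)) (\<lambda>\<omega>. restrict \<omega> {0..<Suc n}) \<bind>
     (\<lambda>\<omega>. distr (P (\<omega> n)) (Pi\<^sub>M {0..<Suc (Suc n)} (\<lambda>_. borel)) (fun_upd \<omega> (Suc n)))"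
proof -
  have "(\<lambda>\<omega>. distr (P (\<omega> n)) (Pi\<^sub>M {0..<Suc (Suc n)} (\<lambda>_. borel)) (fun_upd \<omega> (Suc n))) =
      IT.eP (Suc n)"
    by (simp add: fun_eq_iff IT.eP_def chain_kernel_def)
  then show ?thesis
    unfolding distr_chain_law_eq_C by simp
qed

end

end

theory Submission
  imports Defs
begin

text \<open>If two ergodic measures \<open>\<mu>1\<close> and \<open>\<mu>2\<close> charge \<open>H0\<close>, then the time averages of a test function
  \<open>f\<close> along the chain detect which measure the chain started from, while the coupling \<open>\<Gamma>\<close> forces
  the two averages to agree. For \<open>\<mu>1\<close>-almost every \<open>u0\<close> the averages along the chain from \<open>u0\<close>
  converge almost surely to \<open>\<integral>f d\<mu>1\<close>, and similarly for \<open>\<mu>2\<close>. Since both measures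
  charge \<open>H0\<close>, such points \<open>u0\<close> and \<open>v0\<close> exist inside \<open>H0\<close>. The marginals of \<open>\<Gamma>\<close> are
  absolutely continuous with respect to the two path laws, so both limits also hold
  \<open>\<Gamma>\<close>-almost surely, in particular at some point of the asymptotic diagonal. There the values of
  \<open>f\<close> along the two paths merge, because \<open>f\<close> is Lipschitz for \<open>d\<close>, and so the two limits
  coincide. As such test functions determine measures, \<open>\<mu>1 = \<mu>2\<close>.
  
  It is enough that the averages converge along one fixed subsequence of times, the same for
  both measures. This permits a second moment argument in place of the pathwise ergodic theorem
  for the chain (lemmas \<open>path_second_moment_tendsto_0\<close> and \<open>AE_path_average_tendsto_mean\<close>):
  for \<open>f\<close> with mean zero the second moment of the average over \<open>n\<close> steps is a double sum of
  autocovariances \<open>\<integral>f (P^k f) d\<mu>\<close>, and it vanishes in the limit as soon as the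
  autocovariances vanish in the Cesaro sense.
  
  The latter follows from the almost everywhere convergence to \<open>0\<close> of the averages of the
  iterates \<open>P^k f\<close> (lemma \<open>average_tendsto_0\<close>). The limes superior \<open>h\<close> of these averages
  satisfies \<open>h \<le> P h\<close>; under an invariant measure such functions have \<open>P\<close>-invariant
  superlevel sets (lemma \<open>subharmonic_superlevel_invariant\<close>), which by ergodicity have measure \<open>0\<close>
  or \<open>1\<close>. The Hopf maximal inequality (lemma \<open>maximal_ergodic\<close>) excludes measure \<open>1\<close> for the levels
  above \<open>0\<close>.\<close>

section \<open>Bounded Borel functions\<close>

definition bounded_borel :: "('a::topological_space \<Rightarrow> real) \<Rightarrow> bool" where
  "bounded_borel f \<longleftrightarrow> f \<in> borel_measurable borel \<and> (\<exists>B. \<forall>x. \<bar>f x\<bar> \<le> B)"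

lemma bounded_borelI:
  "f \<in> borel_measurable borel \<Longrightarrow> (\<And>x. \<bar>f x\<bar> \<le> B) \<Longrightarrow> bounded_borel f"
  unfolding bounded_borel_def by blast

lemma bounded_borel_measurable: "bounded_borel f \<Longrightarrow> f \<in> borel_measurable borel"
  unfolding bounded_borel_def by simp

lemma bounded_borelE:
  assumes "bounded_borel f" obtains B where "0 \<le> B" "\<And>x. \<bar>f x\<bar> \<le> B"
  using assms unfolding bounded_borel_def by (meson abs_ge_zero order_trans)

lemma bounded_borel_const [simp]: "bounded_borel (\<lambda>_. c)"
  by (rule bounded_borelI[where B="\<bar>c\<bar>"]) auto

text \<open>The growth bound \<open>k\<close> makes one argument serve for all the arithmetic and lattice operations.\<close>

lemma bounded_borel_comp2:
  assumes f: "bounded_borel f" and g: "bounded_borel g"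
    and h: "continuous_on UNIV (\<lambda>z. h (fst z) (snd z))"
    and le: "\<And>x y B C. \<bar>x\<bar> \<le> B \<Longrightarrow> \<bar>y\<bar> \<le> C \<Longrightarrow> \<bar>h x y\<bar> \<le> k B C"
  shows "bounded_borel (\<lambda>x. h (f x) (g x) :: real)"
proof -
  obtain B C where "\<And>x. \<bar>f x\<bar> \<le> B" "\<And>x. \<bar>g x\<bar> \<le> C"
    using f g by (meson bounded_borelE)
  moreover have "(\<lambda>x. h (f x) (g x)) \<in> borel_measurable borel"
    using borel_measurable_continuous_Pair[OF f[THEN bounded_borel_measurable]
        g[THEN bounded_borel_measurable] h] .
  ultimately show ?thesis
    by (intro bounded_borelI[where B="k B C"] le)
qed

lemma
  assumes "bounded_borel f" "bounded_borel g"
  shows bounded_borel_add: "bounded_borel (\<lambda>x. f x + g x)"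
    and bounded_borel_diff: "bounded_borel (\<lambda>x. f x - g x)"
    and bounded_borel_mult: "bounded_borel (\<lambda>x. f x * g x)"
    and bounded_borel_max: "bounded_borel (\<lambda>x. max (f x) (g x))"
    and bounded_borel_min: "bounded_borel (\<lambda>x. min (f x) (g x))"
proof -
  show "bounded_borel (\<lambda>x. f x + g x)" "bounded_borel (\<lambda>x. f x - g x)"
    "bounded_borel (\<lambda>x. max (f x) (g x))" "bounded_borel (\<lambda>x. min (f x) (g x))"
    by (rule bounded_borel_comp2[OF assms, where k="\<lambda>B C. B + C"]; force intro!: continuous_intros)+
  show "bounded_borel (\<lambda>x. f x * g x)"
    by (rule bounded_borel_comp2[OF assms, where k="\<lambda>B C. B * C"])
       (auto intro!: continuous_intros mult_mono' simp: abs_mult)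
qed

lemma bounded_borel_sum:
  "(\<And>i. i \<in> I \<Longrightarrow> bounded_borel (f i)) \<Longrightarrow> bounded_borel (\<lambda>x. \<Sum>i\<in>I. f i x)"
  by (induction I rule: infinite_finite_induct) (auto intro: bounded_borel_add)

lemma bounded_borel_indicator:
  "A \<in> sets borel \<Longrightarrow> bounded_borel (indicator A)"
  by (rule bounded_borelI[where B=1]) (auto simp: indicator_def)

lemmas bounded_borel_intros = bounded_borel_const bounded_borel_add bounded_borel_diff
  bounded_borel_mult bounded_borel_max bounded_borel_min bounded_borel_sum bounded_borel_indicator

lemma integrable_bounded_borel:
  assumes "bounded_borel f" "finite_measure M" "sets M = sets borel"
  shows "integrable M f"
proof -
  obtain B where "\<And>x. \<bar>f x\<bar> \<le> B"
    using assms(1) by (meson bounded_borelE)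
  moreover have "f \<in> borel_measurable M"
    using bounded_borel_measurable[OF assms(1)] measurable_cong_sets[OF assms(3) refl] by blast
  ultimately show ?thesis
    by (intro finite_measure.integrable_const_bound[OF assms(2), where B=B]) auto
qed

lemma tendsto_integral_bounded:
  fixes g :: "nat \<Rightarrow> 'a::topological_space \<Rightarrow> real"
  assumes "finite_measure M" and sets: "sets M = sets borel"
    and g: "\<And>n. g n \<in> borel_measurable borel" and f: "f \<in> borel_measurable borel"
    and bound: "\<And>n x. \<bar>g n x\<bar> \<le> B"
    and lim: "AE x in M. (\<lambda>n. g n x) \<longlonglongrightarrow> f x"
  shows "(\<lambda>n. \<integral>x. g n x \<partial>M) \<longlonglongrightarrow> (\<integral>x. f x \<partial>M)"
proof (rule integral_dominated_convergence[where w="\<lambda>_. B"])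
  interpret finite_measure M by fact
  show "integrable M (\<lambda>_. B)" by simp
qed (use assms in \<open>auto simp: measurable_cong_sets[OF sets refl]\<close>)

lemma integral_bind_prob_algebra:
  fixes f :: "'b \<Rightarrow> real"
  assumes f: "f \<in> borel_measurable K" and B: "\<And>x. \<bar>f x\<bar> \<le> B"
    and N: "N \<in> M \<rightarrow>\<^sub>M prob_algebra K" and M: "finite_measure M"
  shows "(\<integral>x. f x \<partial>(M \<bind> N)) = (\<integral>x. \<integral>y. f y \<partial>N x \<partial>M)"
proof (rule integral_bind[OF f B measurable_prob_algebraD[OF N] M, where B'=1])
  show "AE x in M. emeasure (N x) (space (N x)) \<le> ennreal 1"
    using measurable_space[OF N]
    by (intro AE_I2) (simp add: space_prob_algebra prob_space.emeasure_space_1)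
qed

section \<open>The Markov operator\<close>

locale markov_operator =
  fixes P :: "'a::polish_space \<Rightarrow> 'a measure"
  assumes kernel: "markov_kernel P"
begin

lemma measurable_P: "P \<in> borel \<rightarrow>\<^sub>M prob_algebra borel"
  using kernel by (simp add: markov_kernel_def)

lemma measurable_P_subprob: "P \<in> borel \<rightarrow>\<^sub>M subprob_algebra borel"
  by (rule measurable_prob_algebraD[OF measurable_P])

lemma prob_space_P: "prob_space (P u)" and sets_P: "sets (P u) = sets borel"
  using measurable_space[OF measurable_P, of u] by (simp_all add: space_prob_algebra)

lemma integrable_P: "bounded_borel f \<Longrightarrow> integrable (P u) f"
  using prob_space_P sets_P by (intro integrable_bounded_borel) (auto simp: prob_space_def)

lemma kernel_op_const [simp]: "kernel_op P (\<lambda>_. c) u = c"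
  using prob_space.prob_space[OF prob_space_P, of u] by (simp add: kernel_op_def)

lemma
  assumes "bounded_borel f" "bounded_borel g"
  shows kernel_op_diff: "kernel_op P (\<lambda>x. f x - g x) u = kernel_op P f u - kernel_op P g u"
    and kernel_op_mono: "(\<And>x. f x \<le> g x) \<Longrightarrow> kernel_op P f u \<le> kernel_op P g u"
  using assms[THEN integrable_P] by (auto simp: kernel_op_def intro!: integral_mono)

lemma kernel_op_cmult: "kernel_op P (\<lambda>x. c * f x) u = c * kernel_op P f u"
  by (simp add: kernel_op_def)

lemma kernel_op_uminus: "kernel_op P (\<lambda>x. - f x) u = - kernel_op P f u"
  by (simp add: kernel_op_def)

lemma kernel_op_sum:
  "(\<And>i. i \<in> I \<Longrightarrow> bounded_borel (f i)) \<Longrightarrow>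
    kernel_op P (\<lambda>x. \<Sum>i\<in>I. f i x) u = (\<Sum>i\<in>I. kernel_op P (f i) u)"
  unfolding kernel_op_def by (rule Bochner_Integration.integral_sum) (rule integrable_P)

lemma abs_kernel_op_le:
  assumes f: "bounded_borel f" and B: "\<And>x. \<bar>f x\<bar> \<le> B"
  shows "\<bar>kernel_op P f u\<bar> \<le> B"
proof -
  have "- B \<le> f x" "f x \<le> B" for x
    using B[of x] by auto
  then show ?thesis
    using kernel_op_mono[OF f bounded_borel_const, of B u]
      kernel_op_mono[OF bounded_borel_const f, of "- B" u] by simp
qed

lemma bounded_borel_kernel_op:
  assumes f: "bounded_borel f" shows "bounded_borel (kernel_op P f)"
proof -
  obtain B where "\<And>x. \<bar>f x\<bar> \<le> B"
    using f by (meson bounded_borelE)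
  moreover have "(\<lambda>u. \<integral>v. f v \<partial>P u) \<in> borel_measurable borel"
    by (rule measurable_compose[OF measurable_P_subprob
          integral_measurable_subprob_algebra[OF bounded_borel_measurable[OF f]]])
  ultimately show ?thesis
    using abs_kernel_op_le[OF f] by (intro bounded_borelI) (auto simp: kernel_op_def[abs_def])
qed

lemma bounded_borel_iterate: "bounded_borel f \<Longrightarrow> bounded_borel ((kernel_op P ^^ n) f)"
  by (induction n) (auto intro: bounded_borel_kernel_op)

lemma abs_iterate_le:
  assumes "bounded_borel f" and "\<And>x. \<bar>f x\<bar> \<le> B"
  shows "\<bar>(kernel_op P ^^ n) f u\<bar> \<le> B"
  using assms
  by (induction n arbitrary: u) (auto intro!: abs_kernel_op_le bounded_borel_iterate)

text \<open>The sum \<open>f + P f + \<dots> + P^(n-1) f\<close>: the expected sum of \<open>f\<close> over the first \<open>n\<close> states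
  of the chain, the starting point included.\<close>

definition iterate_sum :: "('a \<Rightarrow> real) \<Rightarrow> nat \<Rightarrow> 'a \<Rightarrow> real" where
  "iterate_sum f n u = (\<Sum>k<n. (kernel_op P ^^ k) f u)"

lemma bounded_borel_iterate_sum: "bounded_borel f \<Longrightarrow> bounded_borel (iterate_sum f n)"
  unfolding iterate_sum_def by (intro bounded_borel_intros bounded_borel_iterate)

lemma kernel_op_iterate_sum:
  assumes "bounded_borel f"
  shows "kernel_op P (iterate_sum f n) u = (\<Sum>k<n. (kernel_op P ^^ Suc k) f u)"
  unfolding iterate_sum_def by (subst kernel_op_sum) (auto intro: bounded_borel_iterate assms)

lemma iterate_sum_Suc:
  assumes "bounded_borel f"
  shows "iterate_sum f (Suc n) u = f u + kernel_op P (iterate_sum f n) u"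
  unfolding kernel_op_iterate_sum[OF assms] unfolding iterate_sum_def
  by (simp only: sum.lessThan_Suc_shift) simp

lemma iterate_sum_minus_const:
  assumes f: "bounded_borel f"
  shows "iterate_sum (\<lambda>x. f x - c) n u = iterate_sum f n u - real n * c"
proof -
  have "(kernel_op P ^^ k) (\<lambda>x. f x - c) = (\<lambda>x. (kernel_op P ^^ k) f x - c)" for k
  proof (induction k)
    case (Suc k)
    show ?case
      by (rule ext)
         (simp add: Suc kernel_op_diff[OF bounded_borel_iterate[OF f] bounded_borel_const])
  qed simp
  then show ?thesis
    by (simp add: iterate_sum_def sum_subtractf)
qed

lemma iterate_sum_uminus:
  "iterate_sum (\<lambda>x. - f x) n u = - iterate_sum f n u"
proof -
  have "(kernel_op P ^^ k) (\<lambda>x. - f x) = (\<lambda>x. - (kernel_op P ^^ k) f x)" for k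
  proof (induction k)
    case (Suc k)
    show ?case
      by (rule ext) (simp add: Suc kernel_op_uminus)
  qed simp
  then show ?thesis
    by (simp add: iterate_sum_def sum_negf)
qed

lemma abs_iterate_sum_le:
  assumes "bounded_borel f" and "\<And>x. \<bar>f x\<bar> \<le> B"
  shows "\<bar>iterate_sum f n u\<bar> \<le> real n * B"
proof -
  have "\<bar>iterate_sum f n u\<bar> \<le> (\<Sum>k<n. B)"
    unfolding iterate_sum_def
    by (rule order_trans[OF sum_abs sum_mono]) (rule abs_iterate_le[OF assms])
  then show ?thesis by simp
qed

end

section \<open>Subharmonic functions under an invariant measure\<close>

locale markov_invariant = markov_operator +
  fixes \<mu> :: "'a measure"
  assumes invariant: "invariant_measure P \<mu>"
begin

lemma prob_space_mu: "prob_space \<mu>" and sets_mu: "sets \<mu> = sets borel"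
  and bind_mu: "\<mu> \<bind> P = \<mu>"
  using invariant by (auto simp: invariant_measure_def space_prob_algebra)

sublocale mu: prob_space \<mu> by (rule prob_space_mu)

lemma measurable_mu: "measurable \<mu> M = measurable borel M"
  by (rule measurable_cong_sets[OF sets_mu refl])

lemma integrable_mu: "bounded_borel f \<Longrightarrow> integrable \<mu> f"
  by (rule integrable_bounded_borel[OF _ mu.finite_measure_axioms sets_mu])

lemma integral_kernel_op:
  assumes f: "bounded_borel f"
  shows "(\<integral>u. kernel_op P f u \<partial>\<mu>) = (\<integral>u. f u \<partial>\<mu>)"
proof -
  obtain B where B: "\<And>x. \<bar>f x\<bar> \<le> B"
    using f by (meson bounded_borelE)
  have "(\<integral>u. f u \<partial>(\<mu> \<bind> P)) = (\<integral>u. \<integral>v. f v \<partial>P u \<partial>\<mu>)"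
    by (rule integral_bind_prob_algebra[OF bounded_borel_measurable[OF f] B])
       (simp_all add: measurable_mu measurable_P mu.finite_measure_axioms)
  then show ?thesis
    by (simp add: bind_mu kernel_op_def)
qed

lemma integral_iterate:
  "bounded_borel f \<Longrightarrow> (\<integral>u. (kernel_op P ^^ n) f u \<partial>\<mu>) = (\<integral>u. f u \<partial>\<mu>)"
  by (induction n) (auto simp: integral_kernel_op[OF bounded_borel_iterate])

text \<open>\<open>P f - f\<close> is nonnegative and, by invariance, has integral \<open>0\<close>.\<close>

lemma subharmonic_imp_harmonic:
  assumes f: "bounded_borel f" and sub: "AE u in \<mu>. f u \<le> kernel_op P f u"
  shows "AE u in \<mu>. kernel_op P f u = f u"
proof -
  note int = integrable_mu[OF f] integrable_mu[OF bounded_borel_kernel_op[OF f]]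
  have "AE u in \<mu>. kernel_op P f u - f u = 0"
    by (subst integral_nonneg_eq_0_iff_AE[symmetric])
       (use int sub in \<open>auto simp: integral_kernel_op[OF f]\<close>)
  then show ?thesis by simp
qed

lemma superharmonic_imp_harmonic:
  assumes f: "bounded_borel f" and sup: "AE u in \<mu>. kernel_op P f u \<le> f u"
  shows "AE u in \<mu>. kernel_op P f u = f u"
proof -
  have "AE u in \<mu>. kernel_op P (\<lambda>x. 0 - f x) u = 0 - f u"
    using sup by (intro subharmonic_imp_harmonic bounded_borel_intros f)
                 (auto simp: kernel_op_def)
  then show ?thesis by (simp add: kernel_op_def)
qed

text \<open>Positivity of \<open>P\<close> makes the positive part \<open>g\<close> of \<open>f - c\<close>
  subharmonic, hence harmonic almost everywhere. Truncation of the multiples \<open>n g\<close>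
  at \<open>1\<close> yields superharmonic, hence again harmonic functions, and these converge pointwise to the
  indicator of the superlevel set.\<close>

lemma subharmonic_superlevel_invariant:
  fixes c :: real
  assumes f: "bounded_borel f" and sub: "AE u in \<mu>. f u \<le> kernel_op P f u"
  defines "A \<equiv> {u. f u > c}"
  shows "A \<in> sets borel" "AE u in \<mu>. kernel_op P (indicator A) u = indicator A u"
proof -
  show A: "A \<in> sets borel"
    unfolding A_def using bounded_borel_measurable[OF f] by measurable
  define g where "g = (\<lambda>u. max 0 (f u - c))"
  define h where "h = (\<lambda>n u. min 1 (real n * g u))"
  have g: "bounded_borel g"
    unfolding g_def by (intro bounded_borel_intros f)
  have h: "bounded_borel (h n)" for n
    unfolding h_def by (intro bounded_borel_intros g)
  have "AE u in \<mu>. g u \<le> kernel_op P g u"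
    using sub
  proof eventually_elim
    case (elim u)
    have "kernel_op P (\<lambda>x. f x - c) u \<le> kernel_op P g u" "kernel_op P (\<lambda>_. 0) u \<le> kernel_op P g u"
      by (rule kernel_op_mono; (intro bounded_borel_intros f g)?; simp add: g_def)+
    then show ?case
      using elim by (simp add: kernel_op_diff[OF f bounded_borel_const] g_def)
  qed
  then have g_harm: "AE u in \<mu>. kernel_op P g u = g u"
    by (rule subharmonic_imp_harmonic[OF g])
  have "AE u in \<mu>. kernel_op P (h n) u = h n u" for n
  proof (rule superharmonic_imp_harmonic[OF h])
    show "AE u in \<mu>. kernel_op P (h n) u \<le> h n u"
      using g_harm
    proof eventually_elim
      case (elim u)
      have "kernel_op P (h n) u \<le> kernel_op P (\<lambda>_. 1) u"
        "kernel_op P (h n) u \<le> kernel_op P (\<lambda>x. real n * g x) u"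
        by (rule kernel_op_mono; (intro bounded_borel_intros h g)?; simp add: h_def)+
      then show ?case
        using elim by (simp add: h_def kernel_op_cmult)
    qed
  qed
  then have harm: "AE u in \<mu>. \<forall>n. kernel_op P (h n) u = h n u"
    by (simp add: AE_all_countable)
  have lim: "(\<lambda>n. h n u) \<longlonglongrightarrow> indicator A u" for u
  proof (cases "u \<in> A")
    case True
    then have gu: "g u > 0" by (simp add: A_def g_def)
    have "eventually (\<lambda>n. h n u = 1) sequentially"
      using eventually_ge_at_top[of "nat \<lceil>1 / g u\<rceil>"]
    proof eventually_elim
      case (elim n)
      then have "1 / g u \<le> real n" by linarith
      then show ?case using gu by (simp add: h_def field_simps)
    qed
    then show ?thesis using True by (simp add: tendsto_eventually)
  next
    case False
    then show ?thesis by (simp add: h_def g_def A_def)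
  qed
  have klim: "(\<lambda>n. kernel_op P (h n) u) \<longlonglongrightarrow> kernel_op P (indicator A) u" for u
    unfolding kernel_op_def
  proof (rule tendsto_integral_bounded[where B=1])
    show "\<bar>h n x\<bar> \<le> 1" for n x by (simp add: h_def g_def)
  qed (use prob_space_P sets_P lim h[THEN bounded_borel_measurable] A
        in \<open>auto simp: prob_space_def\<close>)
  from harm show "AE u in \<mu>. kernel_op P (indicator A) u = indicator A u"
  proof eventually_elim
    case (elim u)
    have "(\<lambda>n. kernel_op P (h n) u) \<longlonglongrightarrow> indicator A u"
      using elim lim[of u] by simp
    then show ?case
      using klim[of u] LIMSEQ_unique by blast
  qed
qed

end

section \<open>The maximal ergodic inequality\<close>

context markov_operator
begin

text \<open>The value of an optimal stopping problem: at most \<open>n\<close> rewards \<open>f\<close> may be collected along the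
  chain, which may be left at any time. It dominates every expected sum over at most \<open>n\<close> fixed
  steps, and unlike the pointwise maximum of these sums it satisfies an exact recursion.\<close>

fun optimal_sum :: "('a \<Rightarrow> real) \<Rightarrow> nat \<Rightarrow> 'a \<Rightarrow> real" where
  "optimal_sum f 0 u = 0"
| "optimal_sum f (Suc n) u = max 0 (f u + kernel_op P (optimal_sum f n) u)"

lemma bounded_borel_optimal_sum:
  assumes f: "bounded_borel f" shows "bounded_borel (optimal_sum f n)"
proof (induction n)
  case 0
  have "optimal_sum f 0 = (\<lambda>_. 0)" by auto
  then show ?case by simp
next
  case (Suc n)
  have "optimal_sum f (Suc n) = (\<lambda>u. max 0 (f u + kernel_op P (optimal_sum f n) u))" by auto
  then show ?case
    using bounded_borel_kernel_op[OF Suc] f by (auto intro!: bounded_borel_intros)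
qed

lemma optimal_sum_nonneg: "0 \<le> optimal_sum f n u"
  by (cases n) auto

lemma optimal_sum_mono_Suc:
  assumes f: "bounded_borel f"
  shows "optimal_sum f n u \<le> optimal_sum f (Suc n) u"
proof (induction n arbitrary: u)
  case (Suc n)
  have "kernel_op P (optimal_sum f n) u \<le> kernel_op P (optimal_sum f (Suc n)) u"
    by (intro kernel_op_mono bounded_borel_optimal_sum f Suc)
  then show ?case by auto
qed auto

lemma iterate_sum_le_optimal_sum:
  assumes f: "bounded_borel f"
  shows "iterate_sum f n u \<le> optimal_sum f n u"
proof (induction n arbitrary: u)
  case 0
  then show ?case by (simp add: iterate_sum_def)
next
  case (Suc n)
  have "kernel_op P (iterate_sum f n) u \<le> kernel_op P (optimal_sum f n) u"
    by (intro kernel_op_mono bounded_borel_optimal_sum bounded_borel_iterate_sum f Suc)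
  then show ?case by (simp add: iterate_sum_Suc[OF f])
qed

text \<open>Where stopping at once is not optimal, the recursion gives \<open>optimal_sum f n\<close> as
  \<open>f + P (optimal_sum f (n - 1))\<close>, and monotonicity in \<open>n\<close> raises the index. Elsewhere the left
  side is at most \<open>0\<close>.\<close>

lemma optimal_sum_drift:
  assumes f: "bounded_borel f"
  shows "optimal_sum f n u - kernel_op P (optimal_sum f n) u
           \<le> f u * indicator {u. optimal_sum f n u > 0} u"
proof (cases "optimal_sum f n u > 0")
  case True
  then obtain m where m: "n = Suc m" by (cases n) auto
  then have "optimal_sum f n u = f u + kernel_op P (optimal_sum f m) u"
    using True by (auto simp: max_def split: if_splits)
  moreover have "kernel_op P (optimal_sum f m) u \<le> kernel_op P (optimal_sum f n) u"
    unfolding m by (intro kernel_op_mono bounded_borel_optimal_sum f optimal_sum_mono_Suc)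
  ultimately show ?thesis using True by simp
next
  case False
  then have "optimal_sum f n u = 0" using optimal_sum_nonneg[of f n u] by simp
  moreover have "kernel_op P (\<lambda>_. 0) u \<le> kernel_op P (optimal_sum f n) u"
    by (intro kernel_op_mono bounded_borel_optimal_sum f bounded_borel_const optimal_sum_nonneg)
  ultimately show ?thesis by simp
qed

end

context markov_invariant
begin

text \<open>The left side of \<open>optimal_sum_drift\<close> has integral \<open>0\<close> by invariance, so \<open>f\<close> has nonnegative
  integral over the set where the optimal sum is positive. These sets increase to a set of full
  measure.\<close>

lemma maximal_ergodic:
  assumes f: "bounded_borel f" and pos: "AE u in \<mu>. \<exists>n. iterate_sum f n u > 0"
  shows "0 \<le> (\<integral>u. f u \<partial>\<mu>)"
proof -
  define E where "E = (\<lambda>n. {u. optimal_sum f n u > 0})"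
  have E: "E n \<in> sets borel" for n
    unfolding E_def using bounded_borel_measurable[OF bounded_borel_optimal_sum[OF f]] by measurable
  have fE: "bounded_borel (\<lambda>u. f u * indicator (E n) u)" for n
    by (intro bounded_borel_intros f E)
  have "0 \<le> (\<integral>u. f u * indicator (E n) u \<partial>\<mu>)" for n
  proof -
    note M = bounded_borel_optimal_sum[OF f, of n]
    have "0 = (\<integral>u. optimal_sum f n u - kernel_op P (optimal_sum f n) u \<partial>\<mu>)"
      using integrable_mu[OF M] integrable_mu[OF bounded_borel_kernel_op[OF M]]
      by (simp add: integral_kernel_op[OF M])
    also have "\<dots> \<le> (\<integral>u. f u * indicator (E n) u \<partial>\<mu>)"
      unfolding E_def
      by (intro integral_mono integrable_mu optimal_sum_drift f bounded_borel_intros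
          bounded_borel_kernel_op M fE[unfolded E_def] E[unfolded E_def])
    finally show ?thesis .
  qed
  moreover have "(\<lambda>n. \<integral>u. f u * indicator (E n) u \<partial>\<mu>) \<longlonglongrightarrow> (\<integral>u. f u \<partial>\<mu>)"
  proof -
    obtain B where B: "\<And>x. \<bar>f x\<bar> \<le> B" "0 \<le> B"
      using f by (meson bounded_borelE)
    show ?thesis
    proof (rule tendsto_integral_bounded[where B=B])
      show "AE u in \<mu>. (\<lambda>n. f u * indicator (E n) u) \<longlonglongrightarrow> f u"
        using pos
      proof eventually_elim
        case (elim u)
        then obtain n where n: "iterate_sum f n u > 0" by blast
        have "eventually (\<lambda>m. f u * indicator (E m) u = f u) sequentially"
          using eventually_ge_at_top[of n]
        proof eventually_elim
          case (elim m)
          have "optimal_sum f n u \<le> optimal_sum f m u"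
            using elim by (rule lift_Suc_mono_le[where f="\<lambda>n. optimal_sum f n u", OF optimal_sum_mono_Suc[OF f]])
          then have "u \<in> E m"
            using n iterate_sum_le_optimal_sum[OF f, of n u] by (simp add: E_def)
          then show ?case by simp
        qed
        then show ?case by (rule tendsto_eventually)
      qed
      show "\<bar>f x * indicator (E n) x\<bar> \<le> B" for n x
        using B by (auto simp: indicator_def)
    qed (use fE f sets_mu mu.finite_measure_axioms in \<open>auto dest: bounded_borel_measurable\<close>)
  qed
  ultimately show ?thesis
    by (intro LIMSEQ_le_const) auto
qed

end

section \<open>Averages of iterates under an ergodic measure\<close>

locale markov_ergodic = markov_operator +
  fixes \<mu> :: "'a measure"
  assumes ergodic: "ergodic_invariant P \<mu>"
begin

sublocale markov_invariant P \<mu>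
  by standard (use ergodic in \<open>simp add: ergodic_invariant_def\<close>)

text \<open>The limes superior \<open>h\<close> of the averages is subharmonic because \<open>P\<close> changes the average of the
  first \<open>n\<close> iterates by at most \<open>2 B / n\<close>, for \<open>B\<close> a bound of \<open>\<bar>f\<bar>\<close>. If the invariant set \<open>S\<close> where \<open>h\<close> exceeds \<open>e\<close> had
  measure \<open>1\<close>, then almost everywhere some sum of iterates of \<open>f - e\<close> would be positive, and the maximal
  inequality would give \<open>f - e\<close> a nonnegative mean. The factor \<open>2\<close> leaves room to pass from
  \<open>h \<le> e\<close> to a bound on the averages themselves.\<close>

lemma eventually_average_le:
  assumes f: "bounded_borel f" and mean: "(\<integral>u. f u \<partial>\<mu>) = 0" and e: "e > 0"
  shows "AE u in \<mu>. eventually (\<lambda>n. iterate_sum f n u / real n \<le> 2 * e) sequentially"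
proof -
  obtain B where B: "\<And>x. \<bar>f x\<bar> \<le> B" "0 \<le> B"
    using f by (meson bounded_borelE)
  define A where "A = (\<lambda>n u. iterate_sum f n u / real n)"
  \<comment> \<open>The supremum starts at \<open>Suc m\<close>, which keeps out the meaningless average over
    \<open>0\<close> terms and makes \<open>2 * B / Suc m\<close> a bound for the defects of all averages in it.\<close>
  define g where "g = (\<lambda>m u. SUP n\<in>{Suc m..}. A n u)"
  define h where "h = (\<lambda>u. INF m. g m u)"
  have A: "bounded_borel (A n)" for n
    unfolding A_def divide_inverse by (intro bounded_borel_intros bounded_borel_iterate_sum f)
  have AB: "\<bar>A n u\<bar> \<le> B" for n u
    using abs_iterate_sum_le[OF f B(1), of n u] B(2) unfolding A_def
    by (cases "n = 0") (auto simp: field_simps)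
  have bdd: "bdd_above ((\<lambda>n. A n u) ` I)" for I u
    using AB[of _ u] by (intro bdd_aboveI2[where M=B]) (auto simp: abs_le_iff)
  have A_le_g: "A n u \<le> g m u" if "n > m" for n m u
    unfolding g_def using that by (intro cSUP_upper bdd) auto
  have g_ge: "- B \<le> g m u" for m u
    using A_le_g[of m "Suc m" u] AB[of "Suc m" u] by (simp add: abs_le_iff)
  have g_le: "g m u \<le> B" for m u
    unfolding g_def using AB[of _ u] by (intro cSUP_least) (auto simp: abs_le_iff)
  have gB: "\<bar>g m u\<bar> \<le> B" for m u
    using g_ge[of m u] g_le[of m u] by (simp add: abs_le_iff)
  have g: "bounded_borel (g m)" for m
  proof (rule bounded_borelI[where B=B])
    show "g m \<in> borel_measurable borel"
      unfolding g_def
      by (intro borel_measurable_cSUP bounded_borel_measurable[OF A] bdd) auto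
  qed (rule gB)
  have dec: "decseq (\<lambda>m. g m u)" for u
    unfolding g_def decseq_def by (intro allI impI cSUP_subset_mono bdd) auto
  have bddb: "bdd_below (range (\<lambda>m. g m u))" for u
    using g_ge by (intro bdd_belowI2) auto
  have lim: "(\<lambda>m. g m u) \<longlonglongrightarrow> h u" for u
    unfolding h_def by (rule LIMSEQ_decseq_INF[OF bddb dec])
  have h: "bounded_borel h"
  proof (rule bounded_borelI[where B=B])
    show "h \<in> borel_measurable borel"
      by (rule borel_measurable_LIMSEQ_real[OF lim bounded_borel_measurable[OF g]])
    show "\<bar>h u\<bar> \<le> B" for u
      by (rule LIMSEQ_le_const2[OF tendsto_rabs[OF lim]]) (use gB in auto)
  qed
  have h_sub: "h u \<le> kernel_op P h u" for u
  proof -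
    have step: "g m u - 2 * B / real (Suc m) \<le> kernel_op P (g m) u" for m
    proof -
      have "A n u \<le> kernel_op P (g m) u + 2 * B / real (Suc m)" if n: "n \<in> {Suc m..}" for n
      proof -
        have "iterate_sum f n u - kernel_op P (iterate_sum f n) u
            = f u - (kernel_op P ^^ n) f u"
        proof -
          have "(\<Sum>k<Suc n. (kernel_op P ^^ k) f u) = f u + kernel_op P (iterate_sum f n) u"
            using iterate_sum_Suc[OF f, of n u] by (simp only: iterate_sum_def)
          then show ?thesis by (simp add: iterate_sum_def)
        qed
        also have "\<dots> \<le> 2 * B"
          using B(1)[of u] abs_iterate_le[OF f B(1), of n u] by (simp add: abs_le_iff)
        finally have "A n u - kernel_op P (A n) u \<le> 2 * B / real n"
          using n kernel_op_cmult[of "1 / real n" "iterate_sum f n" u]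
          by (simp add: A_def diff_divide_distrib[symmetric] divide_right_mono)
        also have "\<dots> \<le> 2 * B / real (Suc m)"
          using n B(2) by (intro divide_left_mono) auto
        finally show ?thesis
          using kernel_op_mono[OF A g, of n m u] A_le_g[of m n] n by force
      qed
      then have "g m u \<le> kernel_op P (g m) u + 2 * B / real (Suc m)"
        unfolding g_def by (intro cSUP_least) auto
      then show ?thesis by simp
    qed
    have "(\<lambda>m. g m u - 2 * B / real (Suc m)) \<longlonglongrightarrow> h u - 0"
      by (intro tendsto_diff lim LIMSEQ_Suc[OF lim_const_over_n])
    moreover have "(\<lambda>m. kernel_op P (g m) u) \<longlonglongrightarrow> kernel_op P h u"
      unfolding kernel_op_def
      by (rule tendsto_integral_bounded[where B=B])
         (use prob_space_P sets_P lim gB bounded_borel_measurable[OF g]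
            bounded_borel_measurable[OF h] in \<open>auto simp: prob_space_def\<close>)
    ultimately show ?thesis
      using LIMSEQ_le step by fastforce
  qed
  define S where "S = {u. h u > e}"
  have S: "S \<in> sets borel" "AE u in \<mu>. kernel_op P (indicator S) u = indicator S u"
    unfolding S_def using subharmonic_superlevel_invariant[OF h, of e] h_sub by auto
  then have "measure \<mu> S \<in> {0, 1}"
    using ergodic by (simp add: ergodic_invariant_def)
  moreover have "measure \<mu> S \<noteq> 1"
  proof
    assume "measure \<mu> S = 1"
    then have "AE u in \<mu>. u \<in> S"
      by (simp add: mu.prob_eq_1 S(1) sets_mu)
    then have "AE u in \<mu>. \<exists>n. iterate_sum (\<lambda>x. f x - e) n u > 0"
    proof eventually_elim
      case (elim u)
      then have "e < g 0 u"
        using cINF_lower[OF bddb, of 0 u] by (simp add: S_def h_def)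
      then obtain n where "n \<ge> 1" "e < A n u"
        unfolding g_def by (subst (asm) less_cSUP_iff) (auto intro: bdd)
      then have "iterate_sum (\<lambda>x. f x - e) n u > 0"
        by (simp add: A_def iterate_sum_minus_const[OF f] field_simps)
      then show ?case ..
    qed
    then have "0 \<le> (\<integral>u. f u - e \<partial>\<mu>)"
      by (intro maximal_ergodic bounded_borel_intros f)
    also have "\<dots> = - e"
      using integrable_mu[OF f] mean by (simp add: mu.prob_space)
    finally show False using e by simp
  qed
  ultimately have "measure \<mu> S = 0" by simp
  then have "AE u in \<mu>. u \<notin> S"
    using S(1) by (intro AE_not_in) (simp add: null_sets_def sets_mu mu.emeasure_eq_measure)
  then show ?thesis
  proof eventually_elim
    case (elim u)
    then have "h u < 2 * e" using e by (simp add: S_def)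
    then have "eventually (\<lambda>m. g m u < 2 * e) sequentially"
      by (rule order_tendstoD(2)[OF lim])
    then obtain m where m: "g m u < 2 * e"
      by (auto simp: eventually_sequentially)
    show ?case
      using eventually_gt_at_top[of m]
      by eventually_elim (use A_le_g[of m _ u] m in \<open>force simp: A_def\<close>)
  qed
qed

lemma average_tendsto_0:
  assumes f: "bounded_borel f" and mean: "(\<integral>u. f u \<partial>\<mu>) = 0"
  shows "AE u in \<mu>. (\<lambda>n. iterate_sum f n u / real n) \<longlonglongrightarrow> 0"
proof -
  define e where "e = (\<lambda>k. 1 / real (Suc k))"
  have e: "e k > 0" for k by (simp add: e_def)
  have f': "bounded_borel (\<lambda>x. - f x)"
    using bounded_borel_diff[OF bounded_borel_const f, of 0] by simp
  have "AE u in \<mu>. \<forall>k. eventually (\<lambda>n. iterate_sum f n u / real n \<le> 2 * e k) sequentially"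
    using eventually_average_le[OF f mean e] by (simp add: AE_all_countable)
  moreover have "AE u in \<mu>. \<forall>k. eventually (\<lambda>n. iterate_sum (\<lambda>x. - f x) n u / real n \<le> 2 * e k) sequentially"
    using eventually_average_le[OF f' _ e] mean by (simp add: AE_all_countable)
  ultimately show ?thesis
  proof eventually_elim
    case (elim u)
    show ?case
    proof (rule LIMSEQ_I)
      fix r :: real assume "r > 0"
      then obtain k where k: "e k < r / 2"
        using reals_Archimedean[of "r / 2"] by (auto simp: e_def inverse_eq_divide)
      have "eventually (\<lambda>n. norm (iterate_sum f n u / real n - 0) < r) sequentially"
        using spec[OF elim(1), of k] spec[OF elim(2), of k]
        by eventually_elim (use k in \<open>auto simp: iterate_sum_uminus abs_less_iff\<close>)
      then show "\<exists>N. \<forall>n\<ge>N. norm (iterate_sum f n u / real n - 0) < r"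
        by (simp add: eventually_sequentially)
    qed
  qed
qed

definition autocovariance :: "('a \<Rightarrow> real) \<Rightarrow> nat \<Rightarrow> real" where
  "autocovariance f k = (\<integral>u. f u * (kernel_op P ^^ k) f u \<partial>\<mu>)"

text \<open>The Cesaro mean is the integral of \<open>f\<close> against the average of its iterates, so dominated
  convergence applies.\<close>

lemma autocovariance_average_tendsto_0:
  assumes f: "bounded_borel f" and mean: "(\<integral>u. f u \<partial>\<mu>) = 0"
  shows "(\<lambda>n. (\<Sum>k<n. autocovariance f k) / real n) \<longlonglongrightarrow> 0"
proof -
  obtain B where B: "\<And>x. \<bar>f x\<bar> \<le> B" "0 \<le> B"
    using f by (meson bounded_borelE)
  have A: "bounded_borel (\<lambda>u. f u * (iterate_sum f n u / real n))" for n
    unfolding divide_inverse by (intro bounded_borel_intros bounded_borel_iterate_sum f)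
  have "(\<Sum>k<n. autocovariance f k) / real n = (\<integral>u. f u * (iterate_sum f n u / real n) \<partial>\<mu>)" for n
  proof -
    have "(\<Sum>k<n. autocovariance f k) = (\<integral>u. (\<Sum>k<n. f u * (kernel_op P ^^ k) f u) \<partial>\<mu>)"
      unfolding autocovariance_def
      by (intro Bochner_Integration.integral_sum[symmetric] integrable_mu bounded_borel_intros f
          bounded_borel_iterate)
    then show ?thesis
      by (simp add: iterate_sum_def sum_distrib_left)
  qed
  moreover have "(\<lambda>n. \<integral>u. f u * (iterate_sum f n u / real n) \<partial>\<mu>) \<longlonglongrightarrow> (\<integral>u. 0 \<partial>\<mu>)"
  proof (rule tendsto_integral_bounded[where B="B * B"])
    show "AE u in \<mu>. (\<lambda>n. f u * (iterate_sum f n u / real n)) \<longlonglongrightarrow> 0"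
      using average_tendsto_0[OF f mean] by eventually_elim (rule tendsto_mult_right_zero)
    show "\<bar>f u * (iterate_sum f n u / real n)\<bar> \<le> B * B" for n u
    proof -
      have "\<bar>iterate_sum f n u / real n\<bar> \<le> B"
        using abs_iterate_sum_le[OF f B(1), of n u] B(2)
        by (cases "n = 0") (auto simp: field_simps)
      then show ?thesis
        unfolding abs_mult using B by (intro mult_mono) auto
    qed
  qed (use A sets_mu mu.finite_measure_axioms in \<open>auto dest: bounded_borel_measurable\<close>)
  ultimately show ?thesis by (simp only: Bochner_Integration.integral_zero)
qed

end

section \<open>Cesaro means and summable subsequences\<close>

lemma cesaro_tendsto_0:
  fixes a :: "nat \<Rightarrow> real"
  assumes "a \<longlonglongrightarrow> 0"
  shows "(\<lambda>n. (\<Sum>k<n. a k) / real n) \<longlonglongrightarrow> 0"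
proof (rule LIMSEQ_I)
  fix r :: real assume r: "r > 0"
  obtain N where N: "\<And>k. k \<ge> N \<Longrightarrow> \<bar>a k\<bar> < r / 2"
    using LIMSEQ_D[OF assms, of "r / 2"] r by auto
  define K where "K = (\<Sum>k<N. \<bar>a k\<bar>)"
  have bound: "\<bar>\<Sum>k<n. a k\<bar> \<le> K + real n * (r / 2)" if "n \<ge> N" for n
  proof -
    have "\<bar>\<Sum>k<n. a k\<bar> \<le> (\<Sum>k<n. \<bar>a k\<bar>)" by (rule sum_abs)
    also have "\<dots> = K + (\<Sum>k=N..<n. \<bar>a k\<bar>)"
      unfolding K_def using that by (simp add: sum.atLeastLessThan_concat lessThan_atLeast0)
    also have "(\<Sum>k=N..<n. \<bar>a k\<bar>) \<le> (\<Sum>k=N..<n. r / 2)"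
      using N by (intro sum_mono less_imp_le) auto
    also have "\<dots> \<le> real n * (r / 2)"
      using r by (simp add: mult_right_mono)
    finally show ?thesis by simp
  qed
  define n0 where "n0 = max N (Suc (nat \<lceil>2 * K / r\<rceil>))"
  show "\<exists>n0. \<forall>n\<ge>n0. norm ((\<Sum>k<n. a k) / real n - 0) < r"
  proof (intro exI allI impI)
    fix n assume n: "n \<ge> n0"
    then have "2 * K / r < real n" unfolding n0_def by linarith
    then have "K < real n * (r / 2)" using r by (simp add: field_simps)
    moreover have "n > 0" using n by (simp add: n0_def)
    ultimately show "norm ((\<Sum>k<n. a k) / real n - 0) < r"
      using bound[of n] n by (simp add: n0_def field_simps)
  qed
qed

text \<open>Enlarging the square of indices by one row and one column adds every lag from \<open>1\<close> to \<open>n\<close>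
  twice and the lag \<open>0\<close> once.\<close>

lemma sum_lag_eq:
  fixes c :: "nat \<Rightarrow> real"
  shows "(\<Sum>i<n. \<Sum>j<n. c (if i \<le> j then j - i else i - j))
    = (\<Sum>m<n. 2 * (\<Sum>k<Suc m. c k) - c 0)"
proof (induction n)
  case (Suc n)
  let ?d = "\<lambda>i j. c (if i \<le> j then j - i else i - j)"
  have rev: "(\<Sum>i<n. c (n - i)) = (\<Sum>k<n. c (Suc k))"
    by (rule sum.reindex_bij_witness[where i="\<lambda>k. n - Suc k" and j="\<lambda>k. n - Suc k"])
       (auto simp: Suc_diff_Suc)
  have "(\<Sum>i<Suc n. \<Sum>j<Suc n. ?d i j)
      = (\<Sum>i<n. \<Sum>j<n. ?d i j) + (\<Sum>i<n. ?d i n) + (\<Sum>j<n. ?d n j) + c 0"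
    by (simp add: sum.distrib)
  also have "(\<Sum>i<n. ?d i n) = (\<Sum>k<n. c (Suc k))"
    unfolding rev[symmetric] by (rule sum.cong) auto
  also have "(\<Sum>j<n. ?d n j) = (\<Sum>k<n. c (Suc k))"
    unfolding rev[symmetric] by (rule sum.cong) auto
  finally show ?case
    using Suc sum.lessThan_Suc_shift[of c n] by simp
qed simp

text \<open>By \<open>sum_lag_eq\<close> the \<open>m\<close>-th increment \<open>b m\<close> of the double sum is of smaller order than \<open>m\<close>, so the
  sum of the first \<open>n\<close> increments is of smaller order than \<open>n\<^sup>2\<close>.\<close>

lemma sum_lag_tendsto_0:
  fixes c :: "nat \<Rightarrow> real"
  assumes "(\<lambda>n. (\<Sum>k<n. c k) / real n) \<longlonglongrightarrow> 0"
  shows "(\<lambda>n. (\<Sum>i<n. \<Sum>j<n. c (if i \<le> j then j - i else i - j)) / (real n)\<^sup>2) \<longlonglongrightarrow> 0"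
proof -
  define b where "b = (\<lambda>m. 2 * (\<Sum>k<Suc m. c k) - c 0)"
  have "(\<lambda>m. 2 * ((\<Sum>k<Suc m. c k) / real (Suc m)) - c 0 / real (Suc m)) \<longlonglongrightarrow> 2 * 0 - 0"
    by (intro tendsto_diff tendsto_mult tendsto_const LIMSEQ_Suc[OF assms]
        LIMSEQ_Suc[OF lim_const_over_n])
  then have "(\<lambda>m. b m / real (Suc m)) \<longlonglongrightarrow> 0"
    by (simp add: b_def diff_divide_distrib)
  then have "(\<lambda>m. \<bar>b m\<bar> / real (Suc m)) \<longlonglongrightarrow> 0"
    using tendsto_rabs_zero by force
  then have "(\<lambda>n. (\<Sum>m<n. \<bar>b m\<bar> / real (Suc m)) / real n) \<longlonglongrightarrow> 0"
    by (rule cesaro_tendsto_0)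
  then show ?thesis
  proof (rule Lim_null_comparison[rotated])
    have "\<bar>\<Sum>m<n. b m\<bar> / (real n)\<^sup>2 \<le> (\<Sum>m<n. \<bar>b m\<bar> / real (Suc m)) / real n" for n
    proof -
      have "\<bar>\<Sum>m<n. b m\<bar> / (real n)\<^sup>2 \<le> (\<Sum>m<n. \<bar>b m\<bar>) / (real n)\<^sup>2"
        by (intro divide_right_mono sum_abs) auto
      also have "\<dots> = (\<Sum>m<n. \<bar>b m\<bar> / real n) / real n"
        by (simp add: sum_divide_distrib power2_eq_square)
      also have "\<dots> \<le> (\<Sum>m<n. \<bar>b m\<bar> / real (Suc m)) / real n"
        by (intro divide_right_mono sum_mono divide_left_mono) auto
      finally show ?thesis .
    qed
    then show "eventually (\<lambda>n. norm ((\<Sum>i<n. \<Sum>j<n. c (if i \<le> j then j - i else i - j))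
        / (real n)\<^sup>2) \<le> (\<Sum>m<n. \<bar>b m\<bar> / real (Suc m)) / real n) sequentially"
      unfolding sum_lag_eq by (simp add: b_def)
  qed
qed

text \<open>The two ergodic measures must be tested along the same times, since only averages over equally
  many steps can be compared on the asymptotic diagonal.\<close>

lemma ex_common_summable_subsequence:
  fixes a b :: "nat \<Rightarrow> real"
  assumes a: "a \<longlonglongrightarrow> 0" "\<And>n. 0 \<le> a n" and b: "b \<longlonglongrightarrow> 0" "\<And>n. 0 \<le> b n"
  obtains r where "filterlim r at_top sequentially"
    "summable (\<lambda>k. a (r k))" "summable (\<lambda>k. b (r k))"
proof -
  have "\<exists>n\<ge>k. a n < (1/2) ^ k \<and> b n < (1/2) ^ k" for k :: nat
  proof -
    have "eventually (\<lambda>n. n \<ge> k \<and> a n < (1/2) ^ k \<and> b n < (1/2) ^ k) sequentially"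
      by (intro eventually_conj eventually_ge_at_top order_tendstoD(2)[OF a(1)]
          order_tendstoD(2)[OF b(1)]) auto
    then show ?thesis
      by (auto dest: eventually_happens)
  qed
  then obtain r where r: "\<And>k. k \<le> r k" "\<And>k. a (r k) < (1/2) ^ k" "\<And>k. b (r k) < (1/2) ^ k"
    by metis
  show thesis
  proof (rule that)
    show "filterlim r at_top sequentially"
      by (rule filterlim_at_top_mono[OF filterlim_ident]) (simp add: r(1))
    have geo: "summable (\<lambda>k. (1/2 :: real) ^ k)" by (simp add: summable_geometric)
    show "summable (\<lambda>k. a (r k))" "summable (\<lambda>k. b (r k))"
      using a(2) b(2) r(2,3) by (auto intro!: summable_comparison_test'[OF geo] less_imp_le)
  qed
qed

section \<open>Time averages along the chain\<close>

lemma AE_summable_of_summable_integrals: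
  fixes X :: "nat \<Rightarrow> 'b \<Rightarrow> real"
  assumes int: "\<And>k. integrable M (X k)" and nonneg: "\<And>k x. 0 \<le> X k x"
    and sum: "summable (\<lambda>k. \<integral>x. X k x \<partial>M)"
  shows "AE x in M. summable (\<lambda>k. X k x)"
proof -
  have meas: "(\<lambda>x. ennreal (X k x)) \<in> borel_measurable M" for k
    using borel_measurable_integrable[OF int[of k]] by simp
  have "(\<integral>\<^sup>+x. (\<Sum>k. ennreal (X k x)) \<partial>M) = (\<Sum>k. \<integral>\<^sup>+x. ennreal (X k x) \<partial>M)"
    by (rule nn_integral_suminf[OF meas])
  also have "\<dots> = (\<Sum>k. ennreal (\<integral>x. X k x \<partial>M))"
    using int nonneg by (simp add: nn_integral_eq_integral)
  also have "\<dots> \<noteq> \<infinity>"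
    unfolding infinity_ennreal_def
    by (rule ennreal_suminf_neq_top[OF sum]) (simp add: nonneg)
  finally have "AE x in M. (\<Sum>k. ennreal (X k x)) \<noteq> \<infinity>"
    by (intro nn_integral_noteq_infinite borel_measurable_suminf_order meas) simp_all
  then show ?thesis
    by eventually_elim (use nonneg in \<open>auto intro: summable_suminf_not_top\<close>)
qed

context markov_operator
begin

abbreviation chain_from :: "'a \<Rightarrow> (nat \<Rightarrow> 'a) measure" where
  "chain_from u \<equiv> chain_law (return borel u) P"

lemma return_prob: "return borel u \<in> space (prob_algebra borel)"
  by (simp add: space_prob_algebra prob_space_return)

lemmas sets_chain = sets_chain_law[OF kernel return_prob]
lemmas prob_space_chain = prob_space_chain_law[OF kernel return_prob]

lemma measurable_chain: "measurable (chain_from u) M = measurable seq_space M"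
  by (rule measurable_cong_sets[OF sets_chain refl])

lemma measurable_coordinate:
  "f \<in> borel_measurable borel \<Longrightarrow> (\<lambda>\<omega>. f (\<omega> n)) \<in> borel_measurable seq_space"
  by (rule measurable_compose[OF measurable_component_singleton]) auto

text \<open>The Markov property, for functions of a past state. It is read off from the one-step
  description of the finite-dimensional marginals, hence the detour through the restriction of
  the chain to its first \<open>n + 2\<close> coordinates.\<close>

lemma chain_step:
  assumes g: "bounded_borel g" and f: "bounded_borel f" and i: "i \<le> n"
  shows "(\<integral>\<omega>. g (\<omega> i) * f (\<omega> (Suc n)) \<partial>chain_from u)
       = (\<integral>\<omega>. g (\<omega> i) * kernel_op P f (\<omega> n) \<partial>chain_from u)"
proof -
  let ?M = "\<lambda>n. Pi\<^sub>M {0..<n} (\<lambda>_. borel :: 'a measure)"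
  let ?D = "\<lambda>n. distr (chain_from u) (?M n) (\<lambda>\<omega>. restrict \<omega> {0..<n})"
  let ?K = "\<lambda>\<omega>. distr (P (\<omega> n)) (?M (Suc (Suc n))) (fun_upd \<omega> (Suc n))"
  obtain B where B: "\<And>x. \<bar>g x\<bar> \<le> B" "0 \<le> B" using g by (meson bounded_borelE)
  obtain C where C: "\<And>x. \<bar>f x\<bar> \<le> C" "0 \<le> C" using f by (meson bounded_borelE)
  have restr: "(\<lambda>\<omega>. restrict \<omega> {0..<k}) \<in> chain_from u \<rightarrow>\<^sub>M ?M k" for k
    unfolding measurable_chain by (auto intro!: measurable_restrict)
  have prod: "(\<lambda>\<omega>. g (\<omega> i) * f (\<omega> (Suc n))) \<in> borel_measurable (?M (Suc (Suc n)))"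
    using i
    by (intro borel_measurable_times measurable_compose[OF measurable_component_singleton]
        bounded_borel_measurable g f) auto
  have prod': "(\<lambda>\<omega>. g (\<omega> i) * kernel_op P f (\<omega> n)) \<in> borel_measurable (?M (Suc n))"
    using i
    by (intro borel_measurable_times measurable_compose[OF measurable_component_singleton]
        bounded_borel_measurable bounded_borel_kernel_op g f) auto
  have upd: "(\<lambda>p. (fst p)(Suc n := snd p)) \<in> ?M (Suc n) \<Otimes>\<^sub>M borel \<rightarrow>\<^sub>M ?M (Suc (Suc n))"
    by (rule measurable_fun_upd[where J="{0..<Suc n}"]) auto
  have upd1: "fun_upd \<omega> (Suc n) \<in> P (\<omega> n) \<rightarrow>\<^sub>M ?M (Suc (Suc n))" if "\<omega> \<in> space (?M (Suc n))" for \<omega>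
  proof -
    have "(\<lambda>x. (\<omega>, x)) \<in> borel \<rightarrow>\<^sub>M ?M (Suc n) \<Otimes>\<^sub>M (borel :: 'a measure)"
      using that by simp
    from measurable_compose[OF this upd] show ?thesis
      by (simp add: measurable_cong_sets[OF sets_P refl])
  qed
  have K: "?K \<in> ?M (Suc n) \<rightarrow>\<^sub>M prob_algebra (?M (Suc (Suc n)))"
  proof (rule measurable_prob_algebraI)
    show "prob_space (?K \<omega>)" if "\<omega> \<in> space (?M (Suc n))" for \<omega>
      by (rule prob_space.prob_space_distr[OF prob_space_P upd1[OF that]])
    have "(\<lambda>\<omega>. P (\<omega> n)) \<in> ?M (Suc n) \<rightarrow>\<^sub>M subprob_algebra borel"
      by (intro measurable_compose[OF _ measurable_P_subprob] measurable_component_singleton) auto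
    then show "?K \<in> ?M (Suc n) \<rightarrow>\<^sub>M subprob_algebra (?M (Suc (Suc n)))"
      using upd by (intro measurable_distr2[where M=borel]) (auto simp: case_prod_beta')
  qed
  have "(\<integral>\<omega>. g (\<omega> i) * f (\<omega> (Suc n)) \<partial>chain_from u)
      = (\<integral>\<omega>. g (\<omega> i) * f (\<omega> (Suc n)) \<partial>?D (Suc (Suc n)))"
    using i by (subst integral_distr[OF restr prod]) simp
  also have "\<dots> = (\<integral>\<omega>. \<integral>\<omega>'. g (\<omega>' i) * f (\<omega>' (Suc n)) \<partial>?K \<omega> \<partial>?D (Suc n))"
    unfolding chain_law_step[OF kernel return_prob]
  proof (rule integral_bind_prob_algebra[OF prod])
    show "\<bar>g (\<omega> i) * f (\<omega> (Suc n))\<bar> \<le> B * C" for \<omega>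
      unfolding abs_mult using B C by (intro mult_mono) auto
    show "?K \<in> ?D (Suc n) \<rightarrow>\<^sub>M prob_algebra (?M (Suc (Suc n)))"
      using K by simp
    show "finite_measure (?D (Suc n))"
      using prob_space.prob_space_distr[OF prob_space_chain restr] by (simp add: prob_space_def)
  qed
  also have "\<dots> = (\<integral>\<omega>. g (\<omega> i) * kernel_op P f (\<omega> n) \<partial>?D (Suc n))"
  proof (rule Bochner_Integration.integral_cong[OF refl])
    fix \<omega> assume "\<omega> \<in> space (?D (Suc n))"
    then have \<omega>: "\<omega> \<in> space (?M (Suc n))" by simp
    show "(\<integral>\<omega>'. g (\<omega>' i) * f (\<omega>' (Suc n)) \<partial>?K \<omega>) = g (\<omega> i) * kernel_op P f (\<omega> n)"
      using i by (subst integral_distr[OF upd1[OF \<omega>] prod]) (simp add: kernel_op_def)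
  qed
  also have "\<dots> = (\<integral>\<omega>. g (\<omega> i) * kernel_op P f (\<omega> n) \<partial>chain_from u)"
    using i by (subst integral_distr[OF restr prod']) simp
  finally show ?thesis .
qed

lemma chain_steps:
  assumes g: "bounded_borel g" and f: "bounded_borel f"
  shows "(\<integral>\<omega>. g (\<omega> i) * f (\<omega> (i + k)) \<partial>chain_from u)
       = (\<integral>\<omega>. g (\<omega> i) * (kernel_op P ^^ k) f (\<omega> i) \<partial>chain_from u)"
  using f
proof (induction k arbitrary: f)
  case (Suc k)
  have "(\<integral>\<omega>. g (\<omega> i) * f (\<omega> (i + Suc k)) \<partial>chain_from u)
      = (\<integral>\<omega>. g (\<omega> i) * kernel_op P f (\<omega> (i + k)) \<partial>chain_from u)"
    using chain_step[OF g Suc.prems, where i=i and n="i + k"] by simp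
  also have "\<dots> = (\<integral>\<omega>. g (\<omega> i) * (kernel_op P ^^ k) (kernel_op P f) (\<omega> i) \<partial>chain_from u)"
    by (rule Suc.IH[OF bounded_borel_kernel_op[OF Suc.prems]])
  finally show ?case by (simp add: funpow_swap1)
qed simp

lemma chain_expectation:
  assumes f: "bounded_borel f"
  shows "(\<integral>\<omega>. f (\<omega> n) \<partial>chain_from u) = (kernel_op P ^^ n) f u"
proof -
  have "(\<integral>\<omega>. f (\<omega> n) \<partial>chain_from u) = (\<integral>\<omega>. (kernel_op P ^^ n) f (\<omega> 0) \<partial>chain_from u)"
    using chain_steps[OF bounded_borel_const[of 1] f, where i=0 and k=n and u=u] by simp
  also have "\<dots> = (\<integral>x. (kernel_op P ^^ n) f x \<partial>distr (chain_from u) borel (\<lambda>\<omega>. \<omega> 0))"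
    using bounded_borel_measurable[OF bounded_borel_iterate[OF f]]
    by (subst integral_distr) (auto simp: measurable_chain)
  also have "\<dots> = (kernel_op P ^^ n) f u"
    unfolding chain_law_initial[OF kernel return_prob]
    using bounded_borel_measurable[OF bounded_borel_iterate[OF f]]
    by (subst integral_return) auto
  finally show ?thesis .
qed

lemma chain_correlation:
  assumes f: "bounded_borel f"
  shows "(\<integral>\<omega>. f (\<omega> i) * f (\<omega> (i + k)) \<partial>chain_from u)
       = (kernel_op P ^^ i) (\<lambda>x. f x * (kernel_op P ^^ k) f x) u"
  unfolding chain_steps[OF f f]
  by (rule chain_expectation) (intro bounded_borel_intros bounded_borel_iterate f)

definition path_average :: "('a \<Rightarrow> real) \<Rightarrow> nat \<Rightarrow> (nat \<Rightarrow> 'a) \<Rightarrow> real" where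
  "path_average f n \<omega> = (\<Sum>k<n. f (\<omega> k)) / real n"

abbreviation path_from :: "'a \<Rightarrow> (nat \<Rightarrow> 'a) measure" where
  "path_from u \<equiv> path_law (return borel u) P"

lemma measurable_shift: "(\<lambda>\<omega> n. \<omega> (Suc n)) \<in> chain_from u \<rightarrow>\<^sub>M seq_space"
  unfolding measurable_chain by (rule measurable_PiM_single') auto

lemma prob_space_path: "prob_space (path_from u)"
  unfolding path_law_def by (rule prob_space.prob_space_distr[OF prob_space_chain measurable_shift])

lemma sets_path: "sets (path_from u) = sets seq_space"
  by (simp add: path_law_def)

lemma integrable_product:
  assumes f: "bounded_borel f"
  shows "integrable (path_from u) (\<lambda>\<omega>. f (\<omega> i) * f (\<omega> j))"
proof -
  obtain B where B: "\<And>x. \<bar>f x\<bar> \<le> B" "0 \<le> B" using f by (meson bounded_borelE)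
  show ?thesis
  proof (rule finite_measure.integrable_const_bound[where B="B * B"])
    show "finite_measure (path_from u)"
      using prob_space_path by (simp add: prob_space_def)
    show "AE \<omega> in path_from u. norm (f (\<omega> i) * f (\<omega> j)) \<le> B * B"
      using B by (auto simp: abs_mult intro!: mult_mono)
    show "(\<lambda>\<omega>. f (\<omega> i) * f (\<omega> j)) \<in> borel_measurable (path_from u)"
      unfolding measurable_cong_sets[OF sets_path refl]
      by (intro borel_measurable_times measurable_coordinate bounded_borel_measurable f)
  qed
qed

lemma path_average_square:
  "(path_average f n \<omega>)\<^sup>2 = (\<Sum>i<n. \<Sum>j<n. f (\<omega> i) * f (\<omega> j)) / (real n)\<^sup>2"
  by (simp add: path_average_def power_divide power2_eq_square sum_product)

lemma integrable_path_average_square: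
  "bounded_borel f \<Longrightarrow> integrable (path_from u) (\<lambda>\<omega>. (path_average f n \<omega>)\<^sup>2)"
  unfolding path_average_square
  by (intro integrable_divide Bochner_Integration.integrable_sum integrable_product)

definition path_second_moment :: "('a \<Rightarrow> real) \<Rightarrow> nat \<Rightarrow> 'a \<Rightarrow> real" where
  "path_second_moment f n u = (\<integral>\<omega>. (path_average f n \<omega>)\<^sup>2 \<partial>path_from u)"

text \<open>The successor on the right appears because path index \<open>n\<close> is chain time \<open>n + 1\<close>. The
  formula also shows that the correlations are measurable in the starting point, so that they can
  be integrated against an invariant measure.\<close>

lemma path_correlation:
  assumes f: "bounded_borel f"
  shows "(\<integral>\<omega>. f (\<omega> i) * f (\<omega> j) \<partial>path_from u)
       = (kernel_op P ^^ Suc (min i j))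
           (\<lambda>x. f x * (kernel_op P ^^ (if i \<le> j then j - i else i - j)) f x) u"
proof -
  have shift: "(\<integral>\<omega>. f (\<omega> i) * f (\<omega> j) \<partial>path_from u)
      = (\<integral>\<omega>. f (\<omega> (Suc i)) * f (\<omega> (Suc j)) \<partial>chain_from u)" for i j
    unfolding path_law_def
    by (subst integral_distr[OF measurable_shift])
       (intro borel_measurable_times measurable_coordinate bounded_borel_measurable f refl)+
  have le: "(\<integral>\<omega>. f (\<omega> i) * f (\<omega> j) \<partial>path_from u)
      = (kernel_op P ^^ Suc i) (\<lambda>x. f x * (kernel_op P ^^ (j - i)) f x) u" if "i \<le> j" for i j
    using chain_correlation[OF f, where i="Suc i" and k="j - i" and u=u] that unfolding shift by simp
  show ?thesis
  proof (cases "i \<le> j")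
    case True
    then show ?thesis using le[of i j] by (simp add: min_def)
  next
    case False
    then have "(\<integral>\<omega>. f (\<omega> i) * f (\<omega> j) \<partial>path_from u) = (\<integral>\<omega>. f (\<omega> j) * f (\<omega> i) \<partial>path_from u)"
      by (simp add: mult.commute)
    also have "\<dots> = (kernel_op P ^^ Suc j) (\<lambda>x. f x * (kernel_op P ^^ (i - j)) f x) u"
      using False by (intro le) simp
    finally show ?thesis using False by (simp add: min_def)
  qed
qed

lemma path_second_moment_eq:
  assumes f: "bounded_borel f"
  shows "path_second_moment f n u = (\<Sum>i<n. \<Sum>j<n. (kernel_op P ^^ Suc (min i j))
           (\<lambda>x. f x * (kernel_op P ^^ (if i \<le> j then j - i else i - j)) f x) u) / (real n)\<^sup>2"
  unfolding path_second_moment_def path_average_square path_correlation[OF f, symmetric]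
  by (simp add: Bochner_Integration.integral_sum integrable_product[OF f])

lemma bounded_borel_path_second_moment:
  assumes f: "bounded_borel f" shows "bounded_borel (path_second_moment f n)"
  unfolding path_second_moment_eq[OF f, abs_def] divide_inverse
  by (intro bounded_borel_intros bounded_borel_iterate f)

end

context markov_ergodic
begin

text \<open>Integration against \<open>\<mu>\<close> removes the outer iterates \<open>P^(1 + min i j)\<close>, and only the
  autocovariance at lag \<open>|i - j|\<close> remains.\<close>

lemma path_second_moment_tendsto_0:
  assumes f: "bounded_borel f" and mean: "(\<integral>u. f u \<partial>\<mu>) = 0"
  shows "(\<lambda>n. \<integral>u. path_second_moment f n u \<partial>\<mu>) \<longlonglongrightarrow> 0"
proof -
  have g: "bounded_borel (\<lambda>x. f x * (kernel_op P ^^ k) f x)" for k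
    by (intro bounded_borel_intros bounded_borel_iterate f)
  have "(\<integral>u. path_second_moment f n u \<partial>\<mu>)
      = (\<Sum>i<n. \<Sum>j<n. autocovariance f (if i \<le> j then j - i else i - j)) / (real n)\<^sup>2" for n
    unfolding path_second_moment_eq[OF f]
    by (simp add: Bochner_Integration.integral_sum integrable_mu bounded_borel_iterate[OF g]
        bounded_borel_sum integral_iterate[OF g] autocovariance_def
        del: funpow.simps)
  then show ?thesis
    using sum_lag_tendsto_0[OF autocovariance_average_tendsto_0[OF f mean]] by simp
qed

text \<open>Summability of the second moments is passed on twice: over \<open>\<mu>\<close> it gives summable second moments
  for almost every starting point, and over the paths from such a point it gives summable
  squares.\<close>

lemma AE_path_average_tendsto_0:
  assumes f: "bounded_borel f"
    and sum: "summable (\<lambda>k. \<integral>u. path_second_moment f (r k) u \<partial>\<mu>)"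
  shows "AE u in \<mu>. AE \<omega> in path_from u. (\<lambda>k. path_average f (r k) \<omega>) \<longlonglongrightarrow> 0"
proof -
  have "AE u in \<mu>. summable (\<lambda>k. path_second_moment f (r k) u)"
    by (rule AE_summable_of_summable_integrals[OF integrable_mu _ sum])
       (simp add: bounded_borel_path_second_moment[OF f], simp add: path_second_moment_def)
  then show ?thesis
  proof eventually_elim
    case (elim u)
    have "AE \<omega> in path_from u. summable (\<lambda>k. (path_average f (r k) \<omega>)\<^sup>2)"
      using elim
      by (intro AE_summable_of_summable_integrals integrable_path_average_square f)
         (auto simp: path_second_moment_def)
    then show ?case
      by eventually_elim (auto dest!: summable_LIMSEQ_zero)
  qed
qed

lemma AE_path_average_tendsto_mean:
  fixes f :: "'a \<Rightarrow> real"
  defines "c \<equiv> (\<integral>u. f u \<partial>\<mu>)"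
  assumes f: "bounded_borel f" and r: "filterlim r at_top sequentially"
    and sum: "summable (\<lambda>k. \<integral>u. path_second_moment (\<lambda>x. f x - c) (r k) u \<partial>\<mu>)"
  shows "AE u in \<mu>. AE \<omega> in path_from u. (\<lambda>k. path_average f (r k) \<omega>) \<longlonglongrightarrow> c"
proof -
  have f': "bounded_borel (\<lambda>x. f x - c)" by (intro bounded_borel_intros f)
  have avg: "path_average f n \<omega> = path_average (\<lambda>x. f x - c) n \<omega> + c" if "n > 0" for n \<omega>
    using that by (simp add: path_average_def sum_subtractf diff_divide_distrib)
  have "eventually (\<lambda>k. r k > 0) sequentially"
    by (rule eventually_compose_filterlim[OF eventually_gt_at_top r])
  have "(\<lambda>k. path_average f (r k) \<omega>) \<longlonglongrightarrow> c"
    if "(\<lambda>k. path_average (\<lambda>x. f x - c) (r k) \<omega>) \<longlonglongrightarrow> 0" for \<omega>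
  proof (rule Lim_transform_eventually)
    show "(\<lambda>k. path_average (\<lambda>x. f x - c) (r k) \<omega> + c) \<longlonglongrightarrow> c"
      using tendsto_add[OF that tendsto_const, of c] by simp
    show "eventually (\<lambda>k. path_average (\<lambda>x. f x - c) (r k) \<omega> + c = path_average f (r k) \<omega>) sequentially"
      using \<open>eventually (\<lambda>k. r k > 0) sequentially\<close> by eventually_elim (simp add: avg)
  qed
  then show ?thesis
    using AE_path_average_tendsto_0[OF f' sum] by (auto elim!: eventually_mono)
qed

end

section \<open>Uniqueness of the ergodic measure\<close>

lemma (in prob_space) AE_imp_ex_in_set:
  assumes "measure M A > 0" and "AE x in M. Q x"
  shows "\<exists>x\<in>A. Q x"
proof (rule ccontr)
  assume "\<not> (\<exists>x\<in>A. Q x)"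
  then have "AE x in M. x \<notin> A"
    using assms(2) by (auto elim!: eventually_mono)
  moreover have "A \<in> events"
    using assms(1) measure_notin_sets[of A M] by auto
  ultimately have "prob A = 0"
    by (simp add: prob_eq_0)
  then show False using assms(1) by simp
qed

lemma lip_test_function_bound:
  assumes d: "Metric_space UNIV d" and f: "f \<in> lip_test_functions d"
  obtains L where "\<And>u v. \<bar>f u - f v\<bar> \<le> L * d u v"
proof -
  interpret Metric_space UNIV d by (rule d)
  obtain L where L: "\<And>u v. u \<noteq> v \<Longrightarrow> \<bar>f u - f v\<bar> / d u v \<le> L"
    using f by (auto simp: lip_test_functions_def bdd_above_def)
  have "\<bar>f u - f v\<bar> \<le> L * d u v" for u v
  proof (cases "u = v")
    case False
    then have "d u v > 0" by (simp add: mdist_pos_eq)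
    then show ?thesis using L[OF False] by (simp add: field_simps)
  qed simp
  then show thesis by (rule that)
qed

context markov_operator
begin

text \<open>On the asymptotic diagonal the two sequences of values of \<open>f\<close> merge, and hence so do their Cesaro
  means.\<close>

lemma path_average_diff_tendsto_0:
  assumes lip: "\<And>u v. \<bar>f u - f v\<bar> \<le> L * d u v" and uv: "(u, v) \<in> asymp_diagonal d"
  shows "(\<lambda>n. path_average f n u - path_average f n v) \<longlonglongrightarrow> 0"
proof -
  have "(\<lambda>n. L * d (u n) (v n)) \<longlonglongrightarrow> 0"
    using uv by (auto simp: asymp_diagonal_def intro: tendsto_mult_right_zero)
  then have "(\<lambda>n. f (u n) - f (v n)) \<longlonglongrightarrow> 0"
    by (rule Lim_null_comparison[rotated]) (simp add: lip)
  from cesaro_tendsto_0[OF this] show ?thesis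
    by (simp add: path_average_def sum_subtractf diff_divide_distrib)
qed

end

theorem corollary2p1:
  fixes P :: "'a::polish_space \<Rightarrow> 'a measure"
    and d :: "'a \<Rightarrow> 'a \<Rightarrow> real"
    and H0 :: "'a set"
  assumes "markov_kernel P"
    and "Metric_space UNIV d"
    and "determines_measures (lip_test_functions d)"
    and "asymp_diagonal d \<in> sets (seq_space \<Otimes>\<^sub>M seq_space)"
    and "H0 \<in> sets borel"
    and "\<And>u0 v0. u0 \<in> H0 \<Longrightarrow> v0 \<in> H0 \<Longrightarrow>
           \<exists>\<Gamma> \<in> ac_couplings (path_law (return borel u0) P) (path_law (return borel v0) P).
             measure \<Gamma> (asymp_diagonal d) > 0"
  shows "\<exists>\<^sub>\<le>\<^sub>1 \<mu>. ergodic_invariant P \<mu> \<and> measure \<mu> H0 > 0"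
  unfolding Uniq_def
proof (intro allI impI)
  fix \<mu>1 \<mu>2
  assume \<mu>1: "ergodic_invariant P \<mu>1 \<and> measure \<mu>1 H0 > 0"
    and \<mu>2: "ergodic_invariant P \<mu>2 \<and> measure \<mu>2 H0 > 0"
  interpret E1: markov_ergodic P \<mu>1 using assms(1) \<mu>1 by unfold_locales auto
  interpret E2: markov_ergodic P \<mu>2 using assms(1) \<mu>2 by unfold_locales auto
  have "(\<integral>x. f x \<partial>\<mu>1) = (\<integral>x. f x \<partial>\<mu>2)" if f: "f \<in> lip_test_functions d" for f
  proof -
    define c1 where "c1 = (\<integral>x. f x \<partial>\<mu>1)"
    define c2 where "c2 = (\<integral>x. f x \<partial>\<mu>2)"
    have bf: "bounded_borel f"
      using assms(3) f unfolding determines_measures_def bounded_borel_def bounded_iff by auto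
    have centered: "bounded_borel (\<lambda>x. f x - c)" for c
      by (intro bounded_borel_intros bf)
    have mean: "(\<integral>x. f x - c1 \<partial>\<mu>1) = 0" "(\<integral>x. f x - c2 \<partial>\<mu>2) = 0"
      using E1.integrable_mu[OF bf] E2.integrable_mu[OF bf]
      by (simp_all add: c1_def c2_def E1.mu.prob_space E2.mu.prob_space)
    obtain L where L: "\<And>u v. \<bar>f u - f v\<bar> \<le> L * d u v"
      using lip_test_function_bound[OF assms(2) f] by blast
    have nonneg: "0 \<le> (\<integral>u. E1.path_second_moment (\<lambda>x. f x - c) n u \<partial>M)" for c n M
      by (simp add: E1.path_second_moment_def)
    obtain r where r: "filterlim r at_top sequentially"
      "summable (\<lambda>k. \<integral>u. E1.path_second_moment (\<lambda>x. f x - c1) (r k) u \<partial>\<mu>1)"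
      "summable (\<lambda>k. \<integral>u. E1.path_second_moment (\<lambda>x. f x - c2) (r k) u \<partial>\<mu>2)"
      using ex_common_summable_subsequence[OF
          E1.path_second_moment_tendsto_0[OF centered mean(1)] nonneg
          E2.path_second_moment_tendsto_0[OF centered mean(2)] nonneg] by blast
    let ?conv = "\<lambda>c \<omega>. (\<lambda>k. E1.path_average f (r k) \<omega>) \<longlonglongrightarrow> c"
    \<comment> \<open>The same averages are evaluated along both paths; only the limits \<open>c1\<close> and \<open>c2\<close> depend
      on the measure from which the starting point is drawn.\<close>
    obtain u0 where u0: "u0 \<in> H0" "AE \<omega> in E1.path_from u0. ?conv c1 \<omega>"
      using E1.mu.AE_imp_ex_in_set[of H0] \<mu>1
        E1.AE_path_average_tendsto_mean[OF bf r(1)] r(2) unfolding c1_def by blast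
    obtain v0 where v0: "v0 \<in> H0" "AE \<omega> in E1.path_from v0. ?conv c2 \<omega>"
      using E2.mu.AE_imp_ex_in_set[of H0] \<mu>2
        E2.AE_path_average_tendsto_mean[OF bf r(1)] r(3) unfolding c2_def by blast
    obtain \<Gamma> where \<Gamma>: "\<Gamma> \<in> ac_couplings (E1.path_from u0) (E1.path_from v0)"
      and pos: "measure \<Gamma> (asymp_diagonal d) > 0"
      using assms(6)[OF u0(1) v0(1)] by blast
    interpret \<Gamma>: prob_space \<Gamma>
      using \<Gamma> by (simp add: ac_couplings_def space_prob_algebra)
    have sets_\<Gamma>: "sets \<Gamma> = sets (seq_space \<Otimes>\<^sub>M seq_space)"
      using \<Gamma> by (simp add: ac_couplings_def space_prob_algebra)
    have proj: "fst \<in> \<Gamma> \<rightarrow>\<^sub>M seq_space" "snd \<in> \<Gamma> \<rightarrow>\<^sub>M seq_space"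
      by (simp_all add: measurable_cong_sets[OF sets_\<Gamma> refl])
    have "AE \<omega> in distr \<Gamma> seq_space fst. ?conv c1 \<omega>"
      using \<Gamma> by (intro absolutely_continuous_AE[OF _ _ u0(2)])
                   (auto simp: ac_couplings_def E1.sets_path)
    then have fst_conv: "AE p in \<Gamma>. ?conv c1 (fst p)"
      by (rule AE_distrD[OF proj(1)])
    have "AE \<omega> in distr \<Gamma> seq_space snd. ?conv c2 \<omega>"
      using \<Gamma> by (intro absolutely_continuous_AE[OF _ _ v0(2)])
                   (auto simp: ac_couplings_def E1.sets_path)
    then have snd_conv: "AE p in \<Gamma>. ?conv c2 (snd p)"
      by (rule AE_distrD[OF proj(2)])
    have "AE p in \<Gamma>. ?conv c1 (fst p) \<and> ?conv c2 (snd p)"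
      using fst_conv snd_conv by eventually_elim simp
    \<comment> \<open>The almost sure limits and the asymptotic diagonal have a common point, because the
      diagonal has positive \<open>\<Gamma>\<close>-measure.\<close>
    then obtain p where p: "p \<in> asymp_diagonal d" "?conv c1 (fst p)" "?conv c2 (snd p)"
      using \<Gamma>.AE_imp_ex_in_set[OF pos] by blast
    have "(\<lambda>n. E1.path_average f n (fst p) - E1.path_average f n (snd p)) \<longlonglongrightarrow> 0"
      by (rule E1.path_average_diff_tendsto_0[OF L]) (simp add: p(1))
    then have "(\<lambda>k. E1.path_average f (r k) (fst p) - E1.path_average f (r k) (snd p)) \<longlonglongrightarrow> 0"
      by (rule filterlim_compose[OF _ r(1)])
    moreover have "(\<lambda>k. E1.path_average f (r k) (fst p) - E1.path_average f (r k) (snd p))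
        \<longlonglongrightarrow> c1 - c2"
      by (rule tendsto_diff[OF p(2,3)])
    ultimately have "c1 - c2 = 0"
      using LIMSEQ_unique by blast
    then show ?thesis by (simp add: c1_def c2_def)
  qed
  moreover have "\<mu>1 \<in> space (prob_algebra borel)" "\<mu>2 \<in> space (prob_algebra borel)"
    using E1.invariant E2.invariant by (simp_all add: invariant_measure_def)
  ultimately show "\<mu>1 = \<mu>2"
    using assms(3) unfolding determines_measures_def by blast
qed

end
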